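(* Let $r\geq 2$ and $t\ge 2$ be integers. Let $M_1,\dots,M_N$ be matchings of size $t$ in some $r$-uniform hypergraph, with $N\ge (tr+t)^r$. Then there exist distinct indices $i_1,\dots,i_t\in \{1,\dots,N\}$ and pairwise disjoint edges $e_1\in M_{i_1},\dots,e_t\in M_{i_t}$ (i.e., there is a rainbow matching of size $t$).
   Context: An $r$-uniform hypergraph is a hypergraph all of whose edges have exactly $r$ vertices. A matching is a collection of pairwise disjoint edges; its size is the number of edges. An edge may belong to several of the matchings $M_i$. *)

theory Defs
  imports Main "HOL-Library.Disjoint_Sets"
begin

(* A hypergraph is given by its vertex set V and its set E of edges; V may be infinite. *)
definition hypergraph :: "'a set \<Rightarrow> 'a set set \<Rightarrow> bool" where
  "hypergraph V E \<longleftrightarrow> (\<forall>e\<in>E. e \<subseteq> V)"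

definition uniform_hypergraph :: "nat \<Rightarrow> 'a set \<Rightarrow> 'a set set \<Rightarrow> bool" where
  "uniform_hypergraph r V E \<longleftrightarrow> hypergraph V E \<and> (\<forall>e\<in>E. finite e \<and> card e = r)"

definition matching :: "'a set set \<Rightarrow> 'a set set \<Rightarrow> bool" where
  "matching E M \<longleftrightarrow> M \<subseteq> E \<and> disjoint M"

definition matching_of_size :: "'a set set \<Rightarrow> nat \<Rightarrow> 'a set set \<Rightarrow> bool" where
  "matching_of_size E t M \<longleftrightarrow> matching E M \<and> finite M \<and> card M = t"

(* A rainbow matching of size t is listed as e 1, ..., e t together with pairwise
   distinct indices (colours) i 1, ..., i t of matchings containing these edges. *)
definition rainbow_matching ::
  "nat \<Rightarrow> (nat \<Rightarrow> 'a set set) \<Rightarrow> nat \<Rightarrow> (nat \<Rightarrow> nat) \<Rightarrow> (nat \<Rightarrow> 'a set) \<Rightarrow> bool" where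
  "rainbow_matching N M t i e \<longleftrightarrow>
     inj_on i {1..t} \<and> i ` {1..t} \<subseteq> {1..N} \<and>
     (\<forall>j\<in>{1..t}. e j \<in> M (i j)) \<and> disjoint_family_on e {1..t}"

end

theory Submission
  imports Defs Complex_Main
begin

text \<open>
  Call a set \<open>S\<close> rich if, whenever at most \<open>(t - 1) * r\<close> vertices outside \<open>S\<close> and at most
  \<open>t - 1\<close> colours are forbidden, \<open>S\<close> still extends to an edge avoiding them. Disjoint rich sets
  can be replaced greedily by disjoint edges of distinct colours. Call an edge bad if it has no
  rich subset. If the inverse multiplicities of the bad edges of some \<open>M k\<close> sum to at most \<open>1\<close>,
  then these bad edges have distinct representing colours, and replacing every other edge of
  \<open>M k\<close> by a rich subset and extending greedily gives a rainbow matching. Otherwise, summing over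
  all colours shows that there are at least \<open>N\<close> distinct bad edges. But a set that is not rich has
  \<open>(t - 1) * r\<close> vertices and \<open>t - 1\<close> colours covering all edges above it, so a descent from the
  empty set, in which every level costs a factor \<open>(t - 1) * (r + 1)\<close>, leaves fewer than \<open>N\<close> of them.
\<close>

text \<open>The budgets \<open>p\<close> and \<open>q\<close> later become what \<open>t - 1\<close>
  other edges can use up: \<open>(t - 1) * r\<close> vertices and \<open>t - 1\<close>
  colours.\<close>

definition rich :: "nat \<Rightarrow> nat \<Rightarrow> 'c set \<Rightarrow> ('c \<Rightarrow> 'a set set) \<Rightarrow> 'a set \<Rightarrow> bool" where
  "rich p q K M S \<longleftrightarrow>
     (\<forall>W C. finite W \<and> card W \<le> p \<and> W \<inter> S = {} \<and> finite C \<and> card C \<le> q \<longrightarrow>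
        (\<exists>i\<in>K - C. \<exists>e\<in>M i. S \<subseteq> e \<and> e \<inter> W = {}))"

definition bad_edges :: "nat \<Rightarrow> nat \<Rightarrow> 'c set \<Rightarrow> ('c \<Rightarrow> 'a set set) \<Rightarrow> 'a set set" where
  "bad_edges p q K M = {e \<in> (\<Union>i\<in>K. M i). \<forall>S\<subseteq>e. \<not> rich p q K M S}"

text \<open>If \<open>\<Gamma> a\<close> is a largest set, every summand is at least
  \<open>1 / card (\<Gamma> a)\<close>, so the bound on the sum gives
  \<open>card B \<le> card (\<Gamma> a)\<close>. Choosing for \<open>a\<close> last leaves a free
  value, since the rest of \<open>B\<close> takes only \<open>card B - 1\<close> values.\<close>

lemma greedy_representatives:
  fixes \<Gamma> :: "'b \<Rightarrow> 'c set"
  assumes "finite B" and "\<And>b. b \<in> B \<Longrightarrow> finite (\<Gamma> b) \<and> \<Gamma> b \<noteq> {}"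
    and "(\<Sum>b\<in>B. 1 / real (card (\<Gamma> b))) \<le> 1"
  shows "\<exists>c. inj_on c B \<and> (\<forall>b\<in>B. c b \<in> \<Gamma> b)"
  using assms
proof (induction "card B" arbitrary: B)
  case 0
  then show ?case by simp
next
  case (Suc n)
  have "Max ((\<lambda>b. card (\<Gamma> b)) ` B) \<in> (\<lambda>b. card (\<Gamma> b)) ` B"
    using Suc.hyps Suc.prems by (intro Max_in) auto
  then obtain a where a: "a \<in> B" and "card (\<Gamma> a) = Max ((\<lambda>b. card (\<Gamma> b)) ` B)"
    by auto
  then have mx: "card (\<Gamma> b) \<le> card (\<Gamma> a)" if "b \<in> B" for b
    using that Suc.prems(1) by simp
  have pos: "card (\<Gamma> b) > 0" if "b \<in> B" for b
    using that Suc.prems(2) by (simp add: card_gt_0_iff)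
  have "real (card B) * (1 / real (card (\<Gamma> a))) \<le> (\<Sum>b\<in>B. 1 / real (card (\<Gamma> b)))"
    using mx pos by (intro sum_bounded_below) (simp add: frac_le)
  also have "\<dots> \<le> 1" by fact
  finally have big: "card B \<le> card (\<Gamma> a)"
    using pos[OF a] by (simp add: field_simps)
  have "(\<Sum>b\<in>B - {a}. 1 / real (card (\<Gamma> b))) \<le> 1"
    using Suc.prems(1,3) by (intro order_trans[OF sum_mono2 Suc.prems(3)]) auto
  then have "\<exists>c. inj_on c (B - {a}) \<and> (\<forall>b\<in>B - {a}. c b \<in> \<Gamma> b)"
    using a Suc.hyps(2) Suc.prems(1,2) by (intro Suc.hyps(1)) auto
  then obtain c where c: "inj_on c (B - {a})" "\<forall>b\<in>B - {a}. c b \<in> \<Gamma> b"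
    by blast
  have "card (c ` (B - {a})) < card (\<Gamma> a)"
    using big a Suc.prems(1) card_image[OF c(1)] card_Diff1_less[of B a] by simp
  then have "\<not> \<Gamma> a \<subseteq> c ` (B - {a})"
    using Suc.prems(1) by (meson card_mono finite_Diff finite_imageI not_le)
  then obtain x where x: "x \<in> \<Gamma> a" "x \<notin> c ` (B - {a})" by blast
  have "inj_on (c(a := x)) B"
    using c(1) x(2) by (auto simp: inj_on_def)
  moreover have "\<forall>b\<in>B. (c(a := x)) b \<in> \<Gamma> b"
    using c(2) x(1) by auto
  ultimately show ?case by blast
qed

text \<open>\<open>P\<close> holds the positions already filled with edges of distinct colours; the
  values of \<open>c\<close> elsewhere are arbitrary. Each round uses richness to fill one more
  position while the family stays disjoint, until \<open>P = I\<close>.\<close>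

lemma rich_completion:
  fixes M :: "'c \<Rightarrow> 'a set set"
  assumes "finite I" and "card I \<le> Suc q"
    and "P \<subseteq> I"
    and edges: "\<And>i e. i \<in> K \<Longrightarrow> e \<in> M i \<Longrightarrow> finite e \<and> card e \<le> r"
    and "disjoint_family_on g I" and "inj_on c P"
    and "\<And>j. j \<in> I \<Longrightarrow> finite (g j) \<and> card (g j) \<le> r"
    and "\<And>j. j \<in> P \<Longrightarrow> c j \<in> K \<and> g j \<in> M (c j)"
    and "\<And>j. j \<in> I - P \<Longrightarrow> rich (q * r) q K M (g j)"
  shows "\<exists>g c. disjoint_family_on g I \<and> inj_on c I \<and> (\<forall>j\<in>I. c j \<in> K \<and> g j \<in> M (c j))"
  using assms(3,5-)
proof (induction "card (I - P)" arbitrary: P g c)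
  case 0
  then have "P = I" using assms(1) by auto
  with 0 show ?case by blast
next
  case (Suc n)
  then obtain k where k: "k \<in> I" "k \<notin> P"
    by (metis DiffE card.empty ex_in_conv nat.distinct(1))
  \<comment> \<open>The sets still awaiting replacement are avoided too, so that disjointness
    survives the enlargement of \<open>g k\<close>. At most \<open>q\<close> sets of at most
    \<open>r\<close> vertices each are involved, hence the budget \<open>q * r\<close>.\<close>
  define W where "W = (\<Union>j\<in>I - {k}. g j)"
  have cI: "card (I - {k}) \<le> q" using k assms(1,2) by simp
  have "card W \<le> (\<Sum>j\<in>I - {k}. card (g j))"
    unfolding W_def using assms(1) by (intro card_UN_le) simp
  also have "\<dots> \<le> card (I - {k}) * r"
    using Suc.prems(4) sum_bounded_above[of "I - {k}" "\<lambda>j. card (g j)" r] by simp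
  also have "\<dots> \<le> q * r" using cI by simp
  finally have "card W \<le> q * r" .
  moreover have "finite W" unfolding W_def using Suc.prems(4) assms(1) by auto
  moreover have "W \<inter> g k = {}"
    using Suc.prems(2) k unfolding W_def disjoint_family_on_def by fastforce
  moreover have fP: "finite P" using Suc.prems(1) assms(1) finite_subset by blast
  moreover have "card (c ` P) \<le> q"
  proof -
    have "card (c ` P) \<le> card P" using fP by (rule card_image_le)
    also have "\<dots> \<le> card (I - {k})"
      using k Suc.prems(1) assms(1) by (intro card_mono) auto
    finally show ?thesis using cI by simp
  qed
  ultimately obtain i e where ie: "i \<in> K - c ` P" "e \<in> M i" "g k \<subseteq> e" "e \<inter> W = {}"
    using Suc.prems(6)[of k] k unfolding rich_def by (meson DiffI finite_imageI)
  have "I - insert k P = (I - P) - {k}" by auto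
  then have "n = card (I - insert k P)" using Suc.hyps(2) k by simp
  then show ?case
  proof (rule Suc.hyps(1)[where g = "g(k := e)" and c = "c(k := i)"])
    show "insert k P \<subseteq> I" using k Suc.prems(1) by simp
    show "disjoint_family_on (g(k := e)) I"
      using Suc.prems(2) ie(4) unfolding W_def disjoint_family_on_def by auto
    show "inj_on (c(k := i)) (insert k P)"
      using Suc.prems(3) ie(1) k by (auto simp: inj_on_def)
    show "finite ((g(k := e)) j) \<and> card ((g(k := e)) j) \<le> r" if "j \<in> I" for j
      using that Suc.prems(4) ie edges by auto
    show "(c(k := i)) j \<in> K \<and> (g(k := e)) j \<in> M ((c(k := i)) j)" if "j \<in> insert k P" for j
      using that Suc.prems(5) ie k by auto
    show "rich (q * r) q K M ((g(k := e)) j)" if "j \<in> I - insert k P" for j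
      using that Suc.prems(6) by auto
  qed
qed

text \<open>When \<open>S\<close> is not rich, a failing pair \<open>W\<close>, \<open>C\<close>
  splits the bad edges above \<open>S\<close>: those with a colour in \<open>C\<close> number at
  most \<open>q * a\<close>; every other one meets \<open>W\<close>, so it lies above some
  \<open>insert w S\<close>, which leaves at most \<open>p * b\<close>.\<close>

lemma not_rich_card_le:
  fixes M :: "'c \<Rightarrow> 'a set set"
  assumes "finite K" and "\<And>i. i \<in> K \<Longrightarrow> finite (M i)"
    and above: "\<And>i. i \<in> K \<Longrightarrow> card {e \<in> M i. S \<subseteq> e} \<le> a"
    and step: "\<And>w. w \<notin> S \<Longrightarrow> card {e \<in> bad_edges p q K M. insert w S \<subseteq> e} \<le> b"
  shows "card {e \<in> bad_edges p q K M. S \<subseteq> e} \<le> q * a + p * b"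
proof (cases "{e \<in> bad_edges p q K M. S \<subseteq> e} = {}")
  case True
  then show ?thesis by (simp only: card.empty)
next
  case False
  let ?B = "bad_edges p q K M"
  have fB: "finite ?B" using assms(1,2) by (auto simp: bad_edges_def)
  \<comment> \<open>Bad edges have no rich subset, so a single bad edge above \<open>S\<close> rules
    out richness of \<open>S\<close>.\<close>
  from False have "\<not> rich p q K M S" unfolding bad_edges_def by blast
  then obtain W C where W: "finite W" "card W \<le> p" "W \<inter> S = {}"
    and C: "finite C" "card C \<le> q"
    and hit: "\<And>i e. i \<in> K - C \<Longrightarrow> e \<in> M i \<Longrightarrow> S \<subseteq> e \<Longrightarrow> e \<inter> W \<noteq> {}"
    unfolding rich_def by metis
  let ?X = "\<Union>i\<in>C \<inter> K. {e \<in> M i. S \<subseteq> e}"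
  let ?Y = "\<Union>w\<in>W. {e \<in> ?B. insert w S \<subseteq> e}"
  have "e \<in> ?X \<union> ?Y" if e: "e \<in> ?B" "S \<subseteq> e" for e
  proof -
    obtain i where i: "i \<in> K" "e \<in> M i" using e(1) unfolding bad_edges_def by blast
    show ?thesis
    proof (cases "i \<in> C")
      case True
      with i e(2) show ?thesis by blast
    next
      case False
      then obtain w where "w \<in> W" "w \<in> e" using hit i e(2) by blast
      with e show ?thesis by blast
    qed
  qed
  then have "{e \<in> ?B. S \<subseteq> e} \<subseteq> ?X \<union> ?Y" by blast
  moreover have "finite (?X \<union> ?Y)" using W(1) fB assms(1,2) by auto
  ultimately have "card {e \<in> ?B. S \<subseteq> e} \<le> card (?X \<union> ?Y)" by (intro card_mono)
  also have "\<dots> \<le> card ?X + card ?Y" by (rule card_Un_le)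
  also have "card ?X \<le> (\<Sum>i\<in>C \<inter> K. card {e \<in> M i. S \<subseteq> e})"
    using C(1) by (intro card_UN_le) simp
  also have "\<dots> \<le> card (C \<inter> K) * a"
    using above sum_bounded_above[of "C \<inter> K" "\<lambda>i. card {e \<in> M i. S \<subseteq> e}" a] by simp
  also have "\<dots> \<le> q * a"
    using C by (intro mult_right_mono) (auto intro: order_trans[OF card_mono C(2)])
  also have "card ?Y \<le> (\<Sum>w\<in>W. card {e \<in> ?B. insert w S \<subseteq> e})"
    using W(1) by (rule card_UN_le)
  also have "\<dots> \<le> card W * b"
    using step W(3) sum_bounded_above[of W "\<lambda>w. card {e \<in> ?B. insert w S \<subseteq> e}" b]
    by (simp add: disjoint_iff)
  also have "\<dots> \<le> p * b" using W(2) by simp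
  finally show ?thesis by simp
qed

text \<open>Descent on the number \<open>k\<close> of vertices still missing from \<open>S\<close>.
  Distinct edges of a matching cannot share the nonempty set \<open>S\<close>, so the previous count
  applies with \<open>a = 1\<close>.\<close>

lemma card_bad_edges_above_le:
  fixes M :: "'c \<Rightarrow> 'a set set"
  assumes "finite K" and "q > 0"
    and M: "\<And>i. i \<in> K \<Longrightarrow> finite (M i) \<and> disjoint (M i)"
    and edges: "\<And>i e. i \<in> K \<Longrightarrow> e \<in> M i \<Longrightarrow> finite e \<and> card e = r"
    and "finite S" and "S \<noteq> {}" and "card S + k = r"
  shows "card {e \<in> bad_edges (q * r) q K M. S \<subseteq> e} \<le> (q * Suc r) ^ k"
  using assms(5-)
proof (induction k arbitrary: S)
  case 0
  have "e = S" if e: "e \<in> bad_edges (q * r) q K M" "S \<subseteq> e" for e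
  proof -
    obtain i where "i \<in> K" "e \<in> M i" using e(1) unfolding bad_edges_def by blast
    then have "finite e" "card S = card e" using edges 0 by auto
    with e(2) show ?thesis using card_subset_eq by metis
  qed
  then have "{e \<in> bad_edges (q * r) q K M. S \<subseteq> e} \<subseteq> {S}" by blast
  then have "card {e \<in> bad_edges (q * r) q K M. S \<subseteq> e} \<le> card {S}"
    by (intro card_mono) simp_all
  then show ?case by simp
next
  case (Suc k)
  have "card {e \<in> M i. S \<subseteq> e} \<le> 1" if "i \<in> K" for i
  proof -
    have "e = f" if "e \<in> M i" "S \<subseteq> e" "f \<in> M i" "S \<subseteq> f" for e f
      using that M[OF \<open>i \<in> K\<close>] Suc.prems(2) unfolding disjoint_def by blast
    then show ?thesis
      using M[OF that] by (simp add: card_le_Suc0_iff_eq)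
  qed
  moreover have "card {e \<in> bad_edges (q * r) q K M. insert w S \<subseteq> e} \<le> (q * Suc r) ^ k"
    if "w \<notin> S" for w
    using that Suc.prems by (intro Suc.IH) auto
  ultimately have "card {e \<in> bad_edges (q * r) q K M. S \<subseteq> e}
      \<le> q * 1 + (q * r) * (q * Suc r) ^ k"
    using assms(1) M by (intro not_rich_card_le) auto
  \<comment> \<open>The power is at least 1 because \<open>q > 0\<close>, so it can absorb the term
    \<open>q * 1\<close>; the level then costs the factor \<open>q + q * r\<close>.\<close>
  also have "\<dots> \<le> q * (q * Suc r) ^ k + (q * r) * (q * Suc r) ^ k"
    using assms(2) by (intro add_mono mult_left_mono) (auto simp: Suc_le_eq)
  also have "\<dots> = (q * Suc r) ^ Suc k" by (simp add: algebra_simps)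
  finally show ?case .
qed

text \<open>The top level \<open>S = {}\<close> is treated apart: all \<open>t\<close> edges of a
  matching lie above it, so here \<open>a = t\<close>. Singletons are handled by the descent with
  exponent \<open>s = r - 1\<close>.\<close>

lemma card_bad_edges_less:
  fixes M :: "'c \<Rightarrow> 'a set set"
  assumes "finite K" and "r \<ge> 2" and "t \<ge> 2"
    and M: "\<And>i. i \<in> K \<Longrightarrow> finite (M i) \<and> disjoint (M i) \<and> card (M i) = t"
    and edges: "\<And>i e. i \<in> K \<Longrightarrow> e \<in> M i \<Longrightarrow> finite e \<and> card e = r"
  shows "card (bad_edges ((t - 1) * r) (t - 1) K M) < (t * r + t) ^ r"
proof -
  define q where "q = t - 1"
  have t: "t = Suc q" and q: "q > 0" using assms(3) by (auto simp: q_def)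
  obtain s where s: "r = Suc s" "s > 0" using assms(2) by (cases r) auto
  have "card {e \<in> bad_edges (q * r) q K M. insert w {} \<subseteq> e} \<le> (q * Suc r) ^ s" for w
    using assms(1) q M edges s by (intro card_bad_edges_above_le) auto
  then have "card {e \<in> bad_edges (q * r) q K M. {} \<subseteq> e} \<le> q * t + (q * r) * (q * Suc r) ^ s"
    using assms(1) M by (intro not_rich_card_le) auto
  \<comment> \<open>The exponent \<open>s\<close> is positive because \<open>r \<ge> 2\<close>; this
    lets the power absorb the factor \<open>q\<close> of \<open>q * t\<close>.\<close>
  also have "q \<le> (q * Suc r) ^ s"
  proof -
    have "q \<le> q * Suc r" by simp
    also have "\<dots> \<le> (q * Suc r) ^ s" using s q by (intro self_le_power) auto
    finally show ?thesis .
  qed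
  then have "q * t + (q * r) * (q * Suc r) ^ s \<le> (q * Suc r) ^ s * (t + q * r)"
    by (simp add: algebra_simps)
  also have "\<dots> \<le> (t * r + t) ^ s * (t + q * r)"
    by (intro mult_right_mono power_mono) (auto simp: t algebra_simps)
  \<comment> \<open>Strictness comes from \<open>q * r < t * r\<close>.\<close>
  also have "\<dots> < (t * r + t) ^ s * (t * r + t)"
    using s t by (intro mult_strict_left_mono) auto
  also have "\<dots> = (t * r + t) ^ r" by (simp add: s(1))
  finally show ?thesis by (simp add: q_def)
qed

text \<open>Double counting: a bad edge of multiplicity \<open>m\<close> gets weight
  \<open>1 / m\<close> in each of its \<open>m\<close> matchings, hence total weight 1, while every
  colour collects at least 1.\<close>

lemma card_le_card_bad_edges:
  fixes M :: "'c \<Rightarrow> 'a set set"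
  assumes "finite K" and "\<And>i. i \<in> K \<Longrightarrow> finite (M i)"
    and heavy: "\<And>i. i \<in> K \<Longrightarrow>
      1 \<le> (\<Sum>e\<in>M i \<inter> bad_edges p q K M. 1 / real (card {j \<in> K. e \<in> M j}))"
  shows "card K \<le> card (bad_edges p q K M)"
proof -
  let ?B = "bad_edges p q K M"
  let ?m = "\<lambda>e. card {j \<in> K. e \<in> M j}"
  have fB: "finite ?B" using assms(1,2) by (auto simp: bad_edges_def)
  have "real (card K) \<le> (\<Sum>i\<in>K. \<Sum>e\<in>M i \<inter> ?B. 1 / real (?m e))"
    using sum_mono[of K "\<lambda>_. 1::real"] heavy by simp
  also have "\<dots> = (\<Sum>i\<in>K. \<Sum>e | e \<in> ?B \<and> e \<in> M i. 1 / real (?m e))"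
    by (intro sum.cong) auto
  also have "\<dots> = (\<Sum>e\<in>?B. \<Sum>i | i \<in> K \<and> e \<in> M i. 1 / real (?m e))"
    using assms(1) fB by (rule sum.swap_restrict)
  also have "\<dots> = (\<Sum>e\<in>?B. 1)"
    using assms(1) by (intro sum.cong) (auto simp: bad_edges_def card_gt_0_iff)
  finally show ?thesis by simp
qed

theorem theorem2p1:
  fixes r t N :: nat and V :: "'a set" and E :: "'a set set"
    and M :: "nat \<Rightarrow> 'a set set"
  assumes "r \<ge> 2" and "t \<ge> 2"
    and "uniform_hypergraph r V E"
    and "\<And>k. k \<in> {1..N} \<Longrightarrow> matching_of_size E t (M k)"
    and "N \<ge> (t * r + t) ^ r"
  shows "\<exists>i e. rainbow_matching N M t i e"
proof -
  let ?K = "{1..N}"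
  let ?rich = "rich ((t - 1) * r) (t - 1) ?K M"
  let ?B = "bad_edges ((t - 1) * r) (t - 1) ?K M"
  let ?\<Gamma> = "\<lambda>e. {j \<in> ?K. e \<in> M j}"
  have M: "finite (M i) \<and> disjoint (M i) \<and> card (M i) = t" if "i \<in> ?K" for i
    using assms(4)[OF that] by (auto simp: matching_of_size_def matching_def)
  have edges: "finite e \<and> card e = r" if "i \<in> ?K" "e \<in> M i" for i e
    using assms(3) assms(4)[OF that(1)] that(2)
    by (auto simp: matching_of_size_def matching_def uniform_hypergraph_def)
  have "card ?B < card ?K"
    using card_bad_edges_less[OF _ assms(1,2) M edges] assms(5) by fastforce
  \<comment> \<open>With fewer bad edges than colours, some colour has total weight below 1.\<close>
  then obtain k where k: "k \<in> ?K" and light: "(\<Sum>e\<in>M k \<inter> ?B. 1 / real (card (?\<Gamma> e))) < 1"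
    using card_le_card_bad_edges[of ?K M "(t - 1) * r" "t - 1"] M by (meson finite_atLeastAtMost not_le)
  obtain c where c: "inj_on c (M k \<inter> ?B)" "\<forall>e\<in>M k \<inter> ?B. c e \<in> ?\<Gamma> e"
    using greedy_representatives[of "M k \<inter> ?B" ?\<Gamma>] light k M by fastforce
  have "\<exists>S\<subseteq>e. ?rich S" if "e \<in> M k - ?B" for e
    using that k by (auto simp: bad_edges_def)
  then obtain S where S: "\<And>e. e \<in> M k - ?B \<Longrightarrow> S e \<subseteq> e \<and> ?rich (S e)"
    by metis
  \<comment> \<open>Bad edges stay whole, the others shrink to rich subsets; disjointness is
    inherited from \<open>M k\<close>.\<close>
  define g where "g e = (if e \<in> ?B then e else S e)" for e
  have sub: "g e \<subseteq> e" if "e \<in> M k" for e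
    using that S by (auto simp: g_def)
  have "\<exists>g c. disjoint_family_on g (M k) \<and> inj_on c (M k) \<and>
      (\<forall>e\<in>M k. c e \<in> ?K \<and> g e \<in> M (c e))"
  \<comment> \<open>The edges of \<open>M k\<close> themselves serve as positions, and the bad ones,
    already coloured by \<open>c\<close>, are the initial filled part.\<close>
  proof (rule rich_completion[where P = "M k \<inter> ?B" and q = "t - 1" and r = r])
    show "finite (M k)" "card (M k) \<le> Suc (t - 1)" using M[OF k] by auto
    show "M k \<inter> ?B \<subseteq> M k" by blast
    show "disjoint_family_on g (M k)"
      using M[OF k] sub unfolding disjoint_family_on_def disjoint_def by blast
    show "finite (g e) \<and> card (g e) \<le> r" if "e \<in> M k" for e
      using edges[OF k that] sub[OF that] by (auto intro: finite_subset card_mono)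
    show "c e \<in> ?K \<and> g e \<in> M (c e)" if "e \<in> M k \<inter> ?B" for e
      using c(2) that by (auto simp: g_def)
    show "?rich (g e)" if "e \<in> M k - M k \<inter> ?B" for e
      using S that by (auto simp: g_def)
  qed (use c edges in auto)
  then obtain g c where gc: "disjoint_family_on g (M k)" "inj_on c (M k)"
    "\<forall>e\<in>M k. c e \<in> ?K \<and> g e \<in> M (c e)" by blast
  \<comment> \<open>The positions are renumbered by \<open>1, ..., t\<close>, as the definition of a
    rainbow matching requires.\<close>
  obtain h where h: "bij_betw h {1..t} (M k)"
    using ex_bij_betw_nat_finite_1[of "M k"] M[OF k] by auto
  have "rainbow_matching N M t (c \<circ> h) (g \<circ> h)"
    unfolding rainbow_matching_def
  proof (intro conjI)
    show "inj_on (c \<circ> h) {1..t}"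
      using h gc(2) by (auto simp: bij_betw_def intro: comp_inj_on)
    show "(c \<circ> h) ` {1..t} \<subseteq> {1..N}" "\<forall>j\<in>{1..t}. (g \<circ> h) j \<in> M ((c \<circ> h) j)"
      using gc(3) bij_betwE[OF h] by auto
    show "disjoint_family_on (g \<circ> h) {1..t}"
      unfolding disjoint_family_on_def
    proof (intro ballI impI)
      fix a b assume ab: "a \<in> {1..t}" "b \<in> {1..t}" "a \<noteq> b"
      then have "h a \<noteq> h b" using h by (metis bij_betw_imp_inj_on inj_on_contraD)
      then show "(g \<circ> h) a \<inter> (g \<circ> h) b = {}"
        using gc(1) bij_betwE[OF h] ab by (simp add: disjoint_family_on_def)
    qed
  qed
  then show ?thesis by blast
qed

end
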